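(* Let $(\alpha,\beta)\in\mathbb{R}^2$ be simultaneously badly approximable, i.e. there is a constant $c_0>0$ such that $q^{1/2}\max\{|q\alpha-r|,|q\beta-s|\}\ge c_0$ for all integers $q,r,s$ with $q>0$. Let $(q_n,r_n,s_n)_{n\ge0}$ be a sequence of triples of integers with $q_n>0$ for all $n$, satisfying: (i) there is a constant $c_1>0$ with $q_n^{1/2}|q_n\alpha-r_n|\le c_1$ and $q_n^{1/2}|q_n\beta-s_n|\le c_1$ for all $n\ge0$; (ii) there is a constant $c_2\ge1$ with $c_2^{-1}q_{n-1}\le q_n\le c_2q_{n-1}$ for all $n\ge1$; (iii) there exist a positive integer $\chi$ and a real $K>1$ with $q_{n+\chi}\ge Kq_n$ for all $n\ge0$; (iv) for every $n\ge2$, $\Delta_n:=\det\begin{pmatrix}q_n&r_n&s_n\\ q_{n-1}&r_{n-1}&s_{n-1}\\ q_{n-2}&r_{n-2}&s_{n-2}\end{pmatrix}\ne0$. For $n\ge3$ let $(a_n,b_n,c_n)$ be the unique triple of rational numbers such that $q_n=a_nq_{n-1}+b_nq_{n-2}+c_nq_{n-3}$, $r_n=a_nr_{n-1}+b_nr_{n-2}+c_nr_{n-3}$, $s_n=a_ns_{n-1}+b_ns_{n-2}+c_ns_{n-3}$ (unique by (iv)), and put $\mu_n=(a_n,b_n,c_n)$. Suppose that the sequence $(\mu_n)_{n\ge3}$ is recurrent, i.e. for every integer $N\ge3$ there exists an integer $k>0$ such that $\mu_n=\mu_{n+k}$ for all $3\le n\le N$. Then there is a constant $C>0$ depending only on $\alpha$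 and $\beta$ such that for every $\epsilon>0$ and every integer $D\ge1$ there exist integers $Q,R,S$ with $Q>0$ and $\gcd(Q,R,S)=1$ such that $$|Q\alpha-R|\le\epsilon Q^{-1/2},\qquad |Q\beta-S|\le CQ^{-1/2},\qquad Q\equiv R\equiv0 \pmod D.$$ In particular, for every $\epsilon>0$ and every integer $D\ge1$ there exists a triple of integers $(q,r,s)$ with $q>0$ such that $q|q\alpha-r||q\beta-s|\le\epsilon$, $q\equiv r\equiv 0\pmod D$ and $\gcd(q,r,s)=1$. *)

theory Defs
  imports "HOL-Analysis.Analysis" "HOL-Number_Theory.Cong"
begin

definition simultaneously_badly_approximable :: "real \<Rightarrow> real \<Rightarrow> bool" where
  "simultaneously_badly_approximable \<alpha> \<beta> \<longleftrightarrow>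
     (\<exists>c0>0. \<forall>q r s :: int. q > 0 \<longrightarrow>
        sqrt (of_int q) * max \<bar>of_int q * \<alpha> - of_int r\<bar> \<bar>of_int q * \<beta> - of_int s\<bar> \<ge> c0)"

definition consecutive_det :: "(nat \<Rightarrow> int) \<Rightarrow> (nat \<Rightarrow> int) \<Rightarrow> (nat \<Rightarrow> int) \<Rightarrow> nat \<Rightarrow> int" where
  "consecutive_det q r s n =
     det (vector [vector [q n, r n, s n],
                  vector [q (n - 1), r (n - 1), s (n - 1)],
                  vector [q (n - 2), r (n - 2), s (n - 2)]] :: int ^ 3 ^ 3)"

definition good_approximation_sequence ::
    "real \<Rightarrow> real \<Rightarrow> (nat \<Rightarrow> int) \<Rightarrow> (nat \<Rightarrow> int) \<Rightarrow> (nat \<Rightarrow> int) \<Rightarrow> bool" where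
  "good_approximation_sequence \<alpha> \<beta> q r s \<longleftrightarrow>
     (\<forall>n. q n > 0) \<and>
     (\<exists>c1>0. \<forall>n. sqrt (of_int (q n)) * \<bar>of_int (q n) * \<alpha> - of_int (r n)\<bar> \<le> c1 \<and>
                  sqrt (of_int (q n)) * \<bar>of_int (q n) * \<beta> - of_int (s n)\<bar> \<le> c1) \<and>
     (\<exists>c2\<ge>1::real. \<forall>n\<ge>1. inverse c2 * of_int (q (n - 1)) \<le> of_int (q n) \<and>
                            of_int (q n) \<le> c2 * of_int (q (n - 1))) \<and>
     (\<exists>h>0. \<exists>K>1::real. \<forall>n. of_int (q (n + h)) \<ge> K * of_int (q n)) \<and>
     (\<forall>n\<ge>2. consecutive_det q r s n \<noteq> 0)"

(* For n \<ge> 3 the triple \<mu> n is determined uniquely as soon as consecutive_det q r s (n - 1) \<noteq> 0;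
   the values of \<mu> below 3 are irrelevant, here and in recurrent_from_3. *)
definition recurrence_coefficients ::
    "(nat \<Rightarrow> int) \<Rightarrow> (nat \<Rightarrow> int) \<Rightarrow> (nat \<Rightarrow> int) \<Rightarrow> (nat \<Rightarrow> rat \<times> rat \<times> rat) \<Rightarrow> bool" where
  "recurrence_coefficients q r s \<mu> \<longleftrightarrow>
     (\<forall>n\<ge>3. case \<mu> n of (a, b, c) \<Rightarrow>
        of_int (q n) = a * of_int (q (n - 1)) + b * of_int (q (n - 2)) + c * of_int (q (n - 3)) \<and>
        of_int (r n) = a * of_int (r (n - 1)) + b * of_int (r (n - 2)) + c * of_int (r (n - 3)) \<and>
        of_int (s n) = a * of_int (s (n - 1)) + b * of_int (s (n - 2)) + c * of_int (s (n - 3)))"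

definition recurrent_from_3 :: "(nat \<Rightarrow> 'a) \<Rightarrow> bool" where
  "recurrent_from_3 \<mu> \<longleftrightarrow> (\<forall>N\<ge>3. \<exists>k>0. \<forall>n. 3 \<le> n \<and> n \<le> N \<longrightarrow> \<mu> n = \<mu> (n + k))"

end

theory Submission imports Defs begin

text \<open>
  Let \<open>v\<^sub>n = (q\<^sub>n, r\<^sub>n, s\<^sub>n)\<close>. If the coefficients repeat after \<open>k\<close> steps up to a large index, there is a
  linear map \<open>T\<close> with \<open>v\<^sub>n T = v\<^sub>n\<^sub>+\<^sub>k\<close> for all small \<open>n\<close>, and the approximant is \<open>(Q, R, S) = (0, 0, 1) T\<close>.
  Since \<open>(0, 0, 1)\<close> is a fixed combination of \<open>v\<^sub>0, v\<^sub>1, v\<^sub>2\<close>, its image is a fixed combination of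
  \<open>v\<^sub>k, v\<^sub>k\<^sub>+\<^sub>1, v\<^sub>k\<^sub>+\<^sub>2\<close>, so that \<open>Q = O(q\<^sub>k)\<close> and both errors are \<open>O(q\<^sub>k\<^sup>-\<^sup>1\<^sup>/\<^sup>2)\<close>. Recurrence provides
  times \<open>t\<^sub>0 < t\<^sub>1 < \<dots>\<close> all of whose differences are return times, and by the pigeonhole principle
  two of them, \<open>n\<close> and \<open>n + k\<close>, have congruent \<open>v\<close>'s and nearly equal normalised errors
  \<open>q\<^sup>1\<^sup>/\<^sup>2 (q \<alpha> - r)\<close>. Solving for \<open>T\<close> at the index \<open>n\<close>, where the determinants are bounded nonzero
  integers, the congruences make \<open>T\<close> integral and trivial modulo \<open>D\<close>, while the closeness makes the
  first error of \<open>(0, 0, 1) T\<close> small, as the first error of \<open>(0, 0, 1)\<close> itself is \<open>0\<close>. Dividing by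
  the gcd, which is prime to \<open>D\<close>, only improves the approximation.
\<close>

section \<open>Determinants of three sequences at three consecutive indices\<close>

definition casoratian :: "(nat \<Rightarrow> 'a) \<Rightarrow> (nat \<Rightarrow> 'a) \<Rightarrow> (nat \<Rightarrow> 'a) \<Rightarrow> nat \<Rightarrow> 'a::comm_ring_1" where
  "casoratian f g h n =
     f (n + 2) * (g (n + 1) * h n - g n * h (n + 1))
   - g (n + 2) * (f (n + 1) * h n - f n * h (n + 1))
   + h (n + 2) * (f (n + 1) * g n - f n * g (n + 1))"

text \<open>The shift by 2 resolves the truncated subtractions in \<open>consecutive_det\<close>;
  being generic, \<open>casoratian\<close> then serves integer and real sequences alike.\<close>

lemma consecutive_det_eq_casoratian: "consecutive_det q r s (n + 2) = casoratian q r s n"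
  by (simp add: consecutive_det_def casoratian_def det_3 algebra_simps)

text \<open>The expansion has six products, each with one factor from every sequence. Separate
  bounds for the three sequences let a large factor be balanced by small ones.\<close>

lemma casoratian_bound:
  fixes f g h :: "nat \<Rightarrow> real"
  assumes f: "\<And>m. m \<le> 2 \<Longrightarrow> \<bar>f (n + m)\<bar> \<le> F"
    and g: "\<And>m. m \<le> 2 \<Longrightarrow> \<bar>g (n + m)\<bar> \<le> G"
    and h: "\<And>m. m \<le> 2 \<Longrightarrow> \<bar>h (n + m)\<bar> \<le> H"
  shows "\<bar>casoratian f g h n\<bar> \<le> 6 * F * G * H"
proof -
  have nonneg: "0 \<le> F" "0 \<le> G" "0 \<le> H"
    using f[of 0] g[of 0] h[of 0] by linarith+
  have prod: "\<bar>f (n + i) * (g (n + j) * h (n + l))\<bar> \<le> F * (G * H)"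
    if "i \<le> 2" "j \<le> 2" "l \<le> 2" for i j l
    unfolding abs_mult using that nonneg by (intro mult_mono f g h) auto
  have "casoratian f g h n =
      f (n + 2) * (g (n + 1) * h (n + 0)) - f (n + 2) * (g (n + 0) * h (n + 1))
    - f (n + 1) * (g (n + 2) * h (n + 0)) + f (n + 0) * (g (n + 2) * h (n + 1))
    + f (n + 1) * (g (n + 0) * h (n + 2)) - f (n + 0) * (g (n + 1) * h (n + 2))"
    by (simp add: casoratian_def algebra_simps)
  then show ?thesis
    using prod[of 2 1 0] prod[of 2 0 1] prod[of 1 2 0] prod[of 0 2 1] prod[of 1 0 2] prod[of 0 1 2]
    by (simp add: mult.assoc)
qed

text \<open>Multiplicativity of the determinant: the bracket is the determinant of the coefficient
  matrix.\<close>

lemma casoratian_lincomb: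
  fixes f g h u v w :: "nat \<Rightarrow> 'a::comm_ring_1"
  assumes "\<And>m. m \<le> 2 \<Longrightarrow> u (k + m) = X1 * f (n + m) + Y1 * g (n + m) + Z1 * h (n + m)"
    and "\<And>m. m \<le> 2 \<Longrightarrow> v (k + m) = X2 * f (n + m) + Y2 * g (n + m) + Z2 * h (n + m)"
    and "\<And>m. m \<le> 2 \<Longrightarrow> w (k + m) = X3 * f (n + m) + Y3 * g (n + m) + Z3 * h (n + m)"
  shows "casoratian u v w k =
    (X1 * (Y2 * Z3 - Z2 * Y3) - Y1 * (X2 * Z3 - Z2 * X3) + Z1 * (X2 * Y3 - Y2 * X3))
      * casoratian f g h n"
  unfolding casoratian_def
  using assms[of 0] assms[of 1] assms[of 2] by (simp add: algebra_simps)

text \<open>Cramer's rule for the last unknown: the terms in \<open>X\<close> and \<open>Y\<close>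
  repeat a column and vanish.\<close>

lemma casoratian_cramer:
  fixes f g h u :: "nat \<Rightarrow> 'a::comm_ring_1"
  assumes "\<And>m. m \<le> 2 \<Longrightarrow> u (n + m) = X * f (n + m) + Y * g (n + m) + Z * h (n + m)"
  shows "casoratian f g u n = Z * casoratian f g h n"
  using assms[of 0] assms[of 1] assms[of 2] by (simp add: casoratian_def algebra_simps)

lemma casoratian_solve:
  fixes f g h u :: "nat \<Rightarrow> real"
  assumes "casoratian f g h 0 \<noteq> 0" "m \<le> 2"
  shows "u m = casoratian u g h 0 / casoratian f g h 0 * f m
             + casoratian f u h 0 / casoratian f g h 0 * g m
             + casoratian f g u 0 / casoratian f g h 0 * h m"
proof -
  have "casoratian f g h 0 * u m = casoratian u g h 0 * f m + casoratian f u h 0 * g m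
      + casoratian f g u 0 * h m"
    using \<open>m \<le> 2\<close> by (auto simp: casoratian_def numeral_2_eq_2 le_Suc_eq algebra_simps)
  with assms(1) show ?thesis by (simp add: field_simps)
qed

text \<open>The constant \<open>A\<close> depends on \<open>f\<close>, \<open>g\<close>,
  \<open>h\<close> alone. Later \<open>u\<close> is a solution shifted by an arbitrary return time,
  and the bound is uniform in that time.\<close>

lemma casoratian_solve_bounded:
  fixes f g h :: "nat \<Rightarrow> real"
  assumes "casoratian f g h 0 \<noteq> 0"
  shows "\<exists>A>0. \<forall>u M. (\<forall>m\<le>2. \<bar>u m\<bar> \<le> M) \<longrightarrow>
    (\<exists>X Y Z. \<bar>X\<bar> \<le> A * M \<and> \<bar>Y\<bar> \<le> A * M \<and> \<bar>Z\<bar> \<le> A * M \<and>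
       (\<forall>m\<le>2. u m = X * f m + Y * g m + Z * h m))"
proof -
  define B where "B = 1 + (\<Sum>m\<le>2. \<bar>f m\<bar> + \<bar>g m\<bar> + \<bar>h m\<bar>)"
  have le: "\<bar>f m\<bar> + \<bar>g m\<bar> + \<bar>h m\<bar> \<le> B" if "m \<le> 2" for m
    using member_le_sum[of m "{..2}" "\<lambda>m. \<bar>f m\<bar> + \<bar>g m\<bar> + \<bar>h m\<bar>"] that by (auto simp: B_def)
  have B: "\<bar>f (0 + m)\<bar> \<le> B" "\<bar>g (0 + m)\<bar> \<le> B" "\<bar>h (0 + m)\<bar> \<le> B" if "m \<le> 2" for m
    using le[OF that] by auto
  have "B > 0" unfolding B_def by (intro add_pos_nonneg sum_nonneg) auto
  define d where "d = casoratian f g h 0"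
  have d: "\<bar>d\<bar> > 0" using assms by (simp add: d_def)
  define A where "A = 6 * B * B / \<bar>d\<bar>"
  have "A > 0" using \<open>B > 0\<close> d by (simp add: A_def)
  moreover have "\<exists>X Y Z. \<bar>X\<bar> \<le> A * M \<and> \<bar>Y\<bar> \<le> A * M \<and> \<bar>Z\<bar> \<le> A * M \<and>
       (\<forall>m\<le>2. u m = X * f m + Y * g m + Z * h m)" if "\<forall>m\<le>2. \<bar>u m\<bar> \<le> M" for u M
  proof (intro exI conjI allI impI)
    have u: "\<bar>u (0 + m)\<bar> \<le> M" if "m \<le> 2" for m using \<open>\<forall>m\<le>2. \<bar>u m\<bar> \<le> M\<close> that by simp
    show "\<bar>casoratian u g h 0 / d\<bar> \<le> A * M"
      using casoratian_bound[of u 0 M g B h B, OF u B(2,3)] d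
      by (simp add: A_def field_simps abs_divide)
    show "\<bar>casoratian f u h 0 / d\<bar> \<le> A * M"
      using casoratian_bound[of f 0 B u M h B, OF B(1) u B(3)] d
      by (simp add: A_def field_simps abs_divide)
    show "\<bar>casoratian f g u 0 / d\<bar> \<le> A * M"
      using casoratian_bound[of f 0 B g B u M, OF B(1,2) u] d
      by (simp add: A_def field_simps abs_divide)
    show "u m = casoratian u g h 0 / d * f m + casoratian f u h 0 / d * g m
        + casoratian f g u 0 / d * h m" if "m \<le> 2" for m
      unfolding d_def using assms that by (rule casoratian_solve)
  qed
  ultimately show ?thesis by blast
qed

section \<open>Sizes of the denominators and of the approximation errors\<close>

locale approximation_sequence =
  fixes \<alpha> \<beta> :: real and q r s :: "nat \<Rightarrow> int" and \<mu> :: "nat \<Rightarrow> rat \<times> rat \<times> rat"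
    and c1 c2 K :: real and h :: nat
  assumes q_pos: "q n > 0"
    and c1_pos: "c1 > 0"
    and err_\<alpha>: "sqrt (of_int (q n)) * \<bar>of_int (q n) * \<alpha> - of_int (r n)\<bar> \<le> c1"
    and err_\<beta>: "sqrt (of_int (q n)) * \<bar>of_int (q n) * \<beta> - of_int (s n)\<bar> \<le> c1"
    and c2_ge_1: "c2 \<ge> 1"
    and q_le_Suc: "of_int (q n) \<le> c2 * of_int (q (Suc n))"
    and q_Suc_le: "of_int (q (Suc n)) \<le> c2 * of_int (q n)"
    and h_pos: "h > 0" and K_gt_1: "K > 1"
    and q_growth: "of_int (q (n + h)) \<ge> K * of_int (q n)"
    and det_nonzero: "casoratian q r s n \<noteq> 0"
    and coeffs: "recurrence_coefficients q r s \<mu>"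
    and recurrent: "recurrent_from_3 \<mu>"
begin

text \<open>Coordinates adapted to the dynamics: \<open>x\<close> grows, while the signed errors
  \<open>y\<close> and \<open>z\<close> are at most of order \<open>1 / sqrt x\<close>.\<close>

definition x :: "nat \<Rightarrow> real" where "x n = of_int (q n)"
definition y :: "nat \<Rightarrow> real" where "y n = of_int (q n) * \<alpha> - of_int (r n)"
definition z :: "nat \<Rightarrow> real" where "z n = of_int (q n) * \<beta> - of_int (s n)"

lemma x_ge_1: "x n \<ge> 1"
  using q_pos[of n] by (simp add: x_def)

lemma x_pos: "x n > 0"
  using x_ge_1[of n] by linarith

lemma sqrt_x_ge_1: "sqrt (x n) \<ge> 1"
  using x_ge_1[of n] by simp

lemma y_bound: "\<bar>y n\<bar> \<le> c1 / sqrt (x n)"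
  using err_\<alpha>[of n] x_pos[of n] by (simp add: y_def x_def field_simps)

lemma z_bound: "\<bar>z n\<bar> \<le> c1 / sqrt (x n)"
  using err_\<beta>[of n] x_pos[of n] by (simp add: z_def x_def field_simps)

lemma x_add_le: "x (n + m) \<le> c2 ^ m * x n"
proof (induction m)
  case (Suc m)
  have "x (n + Suc m) \<le> c2 * x (n + m)" using q_Suc_le[of "n + m"] by (simp add: x_def)
  also have "\<dots> \<le> c2 * (c2 ^ m * x n)" using Suc c2_ge_1 by (intro mult_left_mono) auto
  finally show ?case by (simp add: mult.assoc)
qed simp

lemma x_le_add: "x n \<le> c2 ^ m * x (n + m)"
proof (induction m)
  case (Suc m)
  have "c2 ^ m * x (n + m) \<le> c2 ^ m * (c2 * x (n + Suc m))"
    using q_le_Suc[of "n + m"] c2_ge_1 by (intro mult_left_mono) (auto simp: x_def)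
  with Suc show ?case by (simp add: algebra_simps)
qed simp

lemma x_near_le: assumes "m \<le> 2" shows "x (n + m) \<le> c2\<^sup>2 * x n"
proof -
  have "c2 ^ m * x n \<le> c2\<^sup>2 * x n"
    using assms c2_ge_1 x_pos[of n] by (intro mult_right_mono power_increasing) auto
  with x_add_le[of n m] show ?thesis by linarith
qed

lemma sqrt_x_le_near: assumes "m \<le> 2" shows "sqrt (x n) \<le> c2 * sqrt (x (n + m))"
proof -
  have "c2 ^ m * x (n + m) \<le> c2\<^sup>2 * x (n + m)"
    using assms c2_ge_1 x_pos[of "n + m"] by (intro mult_right_mono power_increasing) auto
  with x_le_add[of n m] have "x n \<le> c2\<^sup>2 * x (n + m)" by linarith
  then have "sqrt (x n) \<le> sqrt (c2\<^sup>2 * x (n + m))" by simp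
  then show ?thesis using c2_ge_1 by (simp add: real_sqrt_mult)
qed

lemma inverse_sqrt_near:
  assumes "m \<le> 2" shows "c1 / sqrt (x (n + m)) \<le> c1 * c2 / sqrt (x n)"
  using sqrt_x_le_near[OF assms, of n] x_pos[of n] x_pos[of "n + m"] c1_pos
  by (simp add: field_simps)

lemma y_near: assumes "m \<le> 2" shows "\<bar>y (n + m)\<bar> \<le> c1 * c2 / sqrt (x n)"
  using y_bound[of "n + m"] inverse_sqrt_near[OF assms, of n] by linarith

lemma z_near: assumes "m \<le> 2" shows "\<bar>z (n + m)\<bar> \<le> c1 * c2 / sqrt (x n)"
  using z_bound[of "n + m"] inverse_sqrt_near[OF assms, of n] by linarith

lemma x_multiple_h: "K ^ m * x n \<le> x (n + m * h)"
proof (induction m)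
  case (Suc m)
  have "K * (K ^ m * x n) \<le> K * x (n + m * h)" using Suc K_gt_1 by (intro mult_left_mono) auto
  also have "\<dots> \<le> x (n + m * h + h)" using q_growth[of "n + m * h"] by (simp add: x_def)
  finally show ?case by (simp add: algebra_simps)
qed simp

text \<open>Whole blocks of length \<open>h\<close> do not decrease \<open>x\<close>, as
  \<open>K > 1\<close>; each of the fewer than \<open>h\<close> remaining steps loses at most a
  factor \<open>c2\<close>.\<close>

lemma x_quasi_mono: "x n \<le> c2 ^ h * x (n + m)"
proof -
  have "1 \<le> K ^ (m div h)" using K_gt_1 by simp
  then have "x n \<le> K ^ (m div h) * x n" using x_pos[of n] by simp
  also have "\<dots> \<le> x (n + m div h * h)" by (rule x_multiple_h)
  also have "\<dots> \<le> c2 ^ (m mod h) * x (n + m div h * h + m mod h)" by (rule x_le_add)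
  also have "\<dots> \<le> c2 ^ h * x (n + m div h * h + m mod h)"
    using c2_ge_1 h_pos x_pos[of "n + m div h * h + m mod h"]
    by (intro mult_right_mono power_increasing) auto
  finally show ?thesis by (simp add: add.assoc)
qed

lemma x_unbounded: "\<exists>n0. \<forall>n\<ge>n0. x n \<ge> B"
proof -
  \<comment> \<open>The factor \<open>c2 ^ h\<close> pays for the loss in
    \<open>x_quasi_mono\<close>.\<close>
  obtain m where m: "B * c2 ^ h < K ^ m" using real_arch_pow[OF K_gt_1] by blast
  have "x n \<ge> B" if "n \<ge> m * h" for n
  proof -
    have "B * c2 ^ h < K ^ m * x 0"
      using m x_ge_1[of 0] K_gt_1 by (smt (verit) mult_le_cancel_left1 zero_less_power)
    also have "\<dots> \<le> x (m * h)" using x_multiple_h[of m 0] by simp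
    also have "\<dots> \<le> c2 ^ h * x n" using x_quasi_mono[of "m * h" "n - m * h"] that by simp
    finally show ?thesis using c2_ge_1 by (simp add: mult.commute)
  qed
  then show ?thesis by blast
qed

text \<open>The passage from \<open>q\<close>, \<open>r\<close>, \<open>s\<close> to
  \<open>x\<close>, \<open>y\<close>, \<open>z\<close> is linear of determinant 1, since the two
  sign changes cancel.\<close>

lemma casoratian_xyz: "casoratian x y z n = of_int (casoratian q r s n)"
  by (simp add: casoratian_def x_def y_def z_def algebra_simps)

text \<open>A nonzero integer has absolute value at least 1, so the real determinants inherit a
  uniform lower bound.\<close>

lemma casoratian_xyz_abs: "\<bar>casoratian x y z n\<bar> \<ge> 1"
  using det_nonzero[of n] unfolding casoratian_xyz by (simp flip: of_int_abs)

section \<open>Solutions of the recurrence\<close>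

definition a :: "nat \<Rightarrow> real" where "a n = of_rat (fst (\<mu> n))"
definition b :: "nat \<Rightarrow> real" where "b n = of_rat (fst (snd (\<mu> n)))"
definition c :: "nat \<Rightarrow> real" where "c n = of_rat (snd (snd (\<mu> n)))"

definition is_solution :: "(nat \<Rightarrow> real) \<Rightarrow> bool" where
  "is_solution u \<longleftrightarrow> (\<forall>n\<ge>3. u n = a n * u (n - 1) + b n * u (n - 2) + c n * u (n - 3))"

text \<open>\<open>of_rat\<close> carries the rational identities to the reals, where solutions may
  be combined with the coefficients \<alpha> and \<beta>.\<close>

lemma is_solution_qrs:
  "is_solution (\<lambda>n. of_int (q n))" "is_solution (\<lambda>n. of_int (r n))" "is_solution (\<lambda>n. of_int (s n))"
proof -
  have *: "(of_int i :: real) = of_rat A * of_int i1 + of_rat B * of_int i2 + of_rat C * of_int i3"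
    if "(of_int i :: rat) = A * of_int i1 + B * of_int i2 + C * of_int i3" for i i1 i2 i3 A B C
    using arg_cong[OF that, of "of_rat :: rat \<Rightarrow> real"] by (simp add: of_rat_add of_rat_mult)
  show "is_solution (\<lambda>n. of_int (q n))" "is_solution (\<lambda>n. of_int (r n))"
    "is_solution (\<lambda>n. of_int (s n))"
    using coeffs unfolding is_solution_def recurrence_coefficients_def a_def b_def c_def
    by (auto split: prod.splits intro!: *)
qed

lemma is_solution_lincomb:
  assumes "is_solution u" "is_solution v"
  shows "is_solution (\<lambda>n. X * u n + Y * v n)"
  using assms unfolding is_solution_def by (simp add: algebra_simps)

lemma is_solution_xyz: "is_solution x" "is_solution y" "is_solution z"
  using is_solution_qrs(1) is_solution_lincomb[OF is_solution_qrs(1,2), of \<alpha> "-1"]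
    is_solution_lincomb[OF is_solution_qrs(1,3), of \<beta> "-1"]
  by (simp_all add: is_solution_def x_def y_def z_def algebra_simps)

section \<open>Return maps and the size of their coefficients\<close>

definition returns :: "nat \<Rightarrow> nat \<Rightarrow> bool" where
  "returns k N \<longleftrightarrow> (\<forall>n. 3 \<le> n \<and> n \<le> N \<longrightarrow> \<mu> n = \<mu> (n + k))"

text \<open>Up to index \<open>N\<close> the shifted solution obeys the same recurrence as
  \<open>x\<close>, \<open>y\<close>, \<open>z\<close>, so agreement at 0, 1, 2 propagates.\<close>

lemma returns_extend:
  assumes "returns k N" "is_solution u"
    and init: "\<And>m. m \<le> 2 \<Longrightarrow> u (m + k) = X * x m + Y * y m + Z * z m"
    and "n \<le> N"
  shows "u (n + k) = X * x n + Y * y n + Z * z n"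
  using \<open>n \<le> N\<close>
proof (induction n rule: less_induct)
  case (less n)
  show ?case
  proof (cases "n \<le> 2")
    case False
    then have n: "3 \<le> n" "n \<le> N" using less.prems by auto
    then have \<mu>: "\<mu> (n + k) = \<mu> n" using assms(1) by (simp add: returns_def)
    have "u (n + k) = a n * u (n - 1 + k) + b n * u (n - 2 + k) + c n * u (n - 3 + k)"
    proof -
      have "n + k - 1 = n - 1 + k" "n + k - 2 = n - 2 + k" "n + k - 3 = n - 3 + k"
        using n by auto
      then show ?thesis
        using assms(2)[unfolded is_solution_def, rule_format, of "n + k"] n \<mu>
        by (simp add: a_def b_def c_def)
    qed
    also have "\<dots> = X * (a n * x (n - 1) + b n * x (n - 2) + c n * x (n - 3))
        + Y * (a n * y (n - 1) + b n * y (n - 2) + c n * y (n - 3))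
        + Z * (a n * z (n - 1) + b n * z (n - 2) + c n * z (n - 3))"
      using less.IH[of "n - 1"] less.IH[of "n - 2"] less.IH[of "n - 3"] n
      by (simp add: algebra_simps)
    also have "\<dots> = X * x n + Y * y n + Z * z n"
      using is_solution_xyz n by (simp add: is_solution_def)
    finally show ?thesis .
  qed (use init in simp)
qed

text \<open>The system is solved at the indices 0, 1, 2 whatever \<open>k\<close> is, which makes
  \<open>A\<close> independent of \<open>k\<close>, \<open>N\<close> and \<open>u\<close>.\<close>

lemma returns_lincomb:
  "\<exists>A>0. \<forall>k N u M. returns k N \<longrightarrow> is_solution u \<longrightarrow> (\<forall>m\<le>2. \<bar>u (m + k)\<bar> \<le> M) \<longrightarrow>
     (\<exists>X Y Z. \<bar>X\<bar> \<le> A * M \<and> \<bar>Y\<bar> \<le> A * M \<and> \<bar>Z\<bar> \<le> A * M \<and>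
        (\<forall>n\<le>N. u (n + k) = X * x n + Y * y n + Z * z n))"
proof -
  have "casoratian x y z 0 \<noteq> 0" using casoratian_xyz_abs[of 0] by auto
  then obtain A where "A > 0" and A: "\<forall>u M. (\<forall>m\<le>2. \<bar>u m\<bar> \<le> M) \<longrightarrow>
    (\<exists>X Y Z. \<bar>X\<bar> \<le> A * M \<and> \<bar>Y\<bar> \<le> A * M \<and> \<bar>Z\<bar> \<le> A * M \<and>
       (\<forall>m\<le>2. u m = X * x m + Y * y m + Z * z m))"
    using casoratian_solve_bounded by metis
  show ?thesis
  proof (rule exI[of _ A], intro conjI allI impI \<open>A > 0\<close>)
    fix k N u M assume "returns k N" "is_solution u" and M: "\<forall>m\<le>2. \<bar>u (m + k)\<bar> \<le> M"
    from A[rule_format, of "\<lambda>m. u (m + k)" M] M obtain X Y Z where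
      XYZ: "\<bar>X\<bar> \<le> A * M" "\<bar>Y\<bar> \<le> A * M" "\<bar>Z\<bar> \<le> A * M"
      and init: "\<forall>m\<le>2. u (m + k) = X * x m + Y * y m + Z * z m" by auto
    have "\<forall>n\<le>N. u (n + k) = X * x n + Y * y n + Z * z n"
      using returns_extend[OF \<open>returns k N\<close> \<open>is_solution u\<close>] init by blast
    with XYZ show "\<exists>X Y Z. \<bar>X\<bar> \<le> A * M \<and> \<bar>Y\<bar> \<le> A * M \<and> \<bar>Z\<bar> \<le> A * M \<and>
        (\<forall>n\<le>N. u (n + k) = X * x n + Y * y n + Z * z n)" by blast
  qed
qed

text \<open>
  The nine numbers are the matrix of the return map in the basis \<open>(x, y, z)\<close>. The coefficients \<open>X2\<close>, \<open>X3\<close>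
  of the growing solution are much smaller than the others, see \<open>return_unstable_coefficient\<close> below.
\<close>

definition coefficient_bound :: "real \<Rightarrow> bool" where
  "coefficient_bound B \<longleftrightarrow> B > 0 \<and> (\<forall>k N. returns k N \<longrightarrow> (\<exists>X1 Y1 Z1 X2 Y2 Z2 X3 Y3 Z3.
     \<bar>X1\<bar> \<le> B * x k \<and> \<bar>Y1\<bar> \<le> B * x k \<and> \<bar>Z1\<bar> \<le> B * x k \<and>
     \<bar>Y2\<bar> \<le> B / sqrt (x k) \<and> \<bar>Z2\<bar> \<le> B / sqrt (x k) \<and>
     \<bar>Y3\<bar> \<le> B / sqrt (x k) \<and> \<bar>Z3\<bar> \<le> B / sqrt (x k) \<and>
     (\<forall>n\<le>N. x (n + k) = X1 * x n + Y1 * y n + Z1 * z n \<and>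
             y (n + k) = X2 * x n + Y2 * y n + Z2 * z n \<and>
             z (n + k) = X3 * x n + Y3 * y n + Z3 * z n)))"

lemma coefficient_boundE:
  assumes "coefficient_bound B" "returns k N"
  obtains X1 Y1 Z1 X2 Y2 Z2 X3 Y3 Z3 where
    "\<bar>X1\<bar> \<le> B * x k" "\<bar>Y1\<bar> \<le> B * x k" "\<bar>Z1\<bar> \<le> B * x k"
    "\<bar>Y2\<bar> \<le> B / sqrt (x k)" "\<bar>Z2\<bar> \<le> B / sqrt (x k)"
    "\<bar>Y3\<bar> \<le> B / sqrt (x k)" "\<bar>Z3\<bar> \<le> B / sqrt (x k)"
    "\<And>n. n \<le> N \<Longrightarrow> x (n + k) = X1 * x n + Y1 * y n + Z1 * z n"
    "\<And>n. n \<le> N \<Longrightarrow> y (n + k) = X2 * x n + Y2 * y n + Z2 * z n"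
    "\<And>n. n \<le> N \<Longrightarrow> z (n + k) = X3 * x n + Y3 * y n + Z3 * z n"
proof -
  have "(\<exists>X1 Y1 Z1 X2 Y2 Z2 X3 Y3 Z3.
     \<bar>X1\<bar> \<le> B * x k \<and> \<bar>Y1\<bar> \<le> B * x k \<and> \<bar>Z1\<bar> \<le> B * x k \<and>
     \<bar>Y2\<bar> \<le> B / sqrt (x k) \<and> \<bar>Z2\<bar> \<le> B / sqrt (x k) \<and>
     \<bar>Y3\<bar> \<le> B / sqrt (x k) \<and> \<bar>Z3\<bar> \<le> B / sqrt (x k) \<and>
     (\<forall>n\<le>N. x (n + k) = X1 * x n + Y1 * y n + Z1 * z n \<and>
             y (n + k) = X2 * x n + Y2 * y n + Z2 * z n \<and>
             z (n + k) = X3 * x n + Y3 * y n + Z3 * z n))"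
    using assms unfolding coefficient_bound_def by blast
  then show thesis by (elim exE conjE) (rule that, auto)
qed

text \<open>The coefficients are controlled by the values at \<open>k\<close>, \<open>k + 1\<close>,
  \<open>k + 2\<close>, which are of order \<open>x k\<close> for \<open>x\<close> and at most of
  order \<open>1 / sqrt (x k)\<close> for \<open>y\<close> and \<open>z\<close>.\<close>

lemma coefficient_bound_exists: "\<exists>B. coefficient_bound B"
proof -
  obtain A where "A > 0" and A: "\<And>k N u M. returns k N \<Longrightarrow> is_solution u \<Longrightarrow>
      (\<forall>m\<le>2. \<bar>u (m + k)\<bar> \<le> M) \<Longrightarrow>
     (\<exists>X Y Z. \<bar>X\<bar> \<le> A * M \<and> \<bar>Y\<bar> \<le> A * M \<and> \<bar>Z\<bar> \<le> A * M \<and>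
        (\<forall>n\<le>N. u (n + k) = X * x n + Y * y n + Z * z n))"
    using returns_lincomb by metis
  define B where "B = A * (c2\<^sup>2 + c1 * c2)"
  have "B > 0" using \<open>A > 0\<close> c1_pos c2_ge_1 by (simp add: B_def add_pos_pos)
  have B: "A * c2\<^sup>2 \<le> B" "A * (c1 * c2) \<le> B"
    using \<open>A > 0\<close> c1_pos c2_ge_1 by (simp_all add: B_def algebra_simps)
  have "\<exists>X1 Y1 Z1 X2 Y2 Z2 X3 Y3 Z3.
     \<bar>X1\<bar> \<le> B * x k \<and> \<bar>Y1\<bar> \<le> B * x k \<and> \<bar>Z1\<bar> \<le> B * x k \<and>
     \<bar>Y2\<bar> \<le> B / sqrt (x k) \<and> \<bar>Z2\<bar> \<le> B / sqrt (x k) \<and>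
     \<bar>Y3\<bar> \<le> B / sqrt (x k) \<and> \<bar>Z3\<bar> \<le> B / sqrt (x k) \<and>
     (\<forall>n\<le>N. x (n + k) = X1 * x n + Y1 * y n + Z1 * z n \<and>
             y (n + k) = X2 * x n + Y2 * y n + Z2 * z n \<and>
             z (n + k) = X3 * x n + Y3 * y n + Z3 * z n)" if ret: "returns k N" for k N
  proof -
    have "\<forall>m\<le>2. \<bar>x (m + k)\<bar> \<le> c2\<^sup>2 * x k"
      using x_near_le[of _ k] x_pos by (simp add: add.commute abs_of_pos)
    from A[OF ret is_solution_xyz(1) this] obtain X1 Y1 Z1 where
      1: "\<bar>X1\<bar> \<le> A * (c2\<^sup>2 * x k)" "\<bar>Y1\<bar> \<le> A * (c2\<^sup>2 * x k)" "\<bar>Z1\<bar> \<le> A * (c2\<^sup>2 * x k)"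
      "\<forall>n\<le>N. x (n + k) = X1 * x n + Y1 * y n + Z1 * z n" by blast
    have "\<forall>m\<le>2. \<bar>y (m + k)\<bar> \<le> c1 * c2 / sqrt (x k)"
      using y_near[of _ k] by (simp add: add.commute)
    from A[OF ret is_solution_xyz(2) this] obtain X2 Y2 Z2 where
      2: "\<bar>Y2\<bar> \<le> A * (c1 * c2 / sqrt (x k))" "\<bar>Z2\<bar> \<le> A * (c1 * c2 / sqrt (x k))"
      "\<forall>n\<le>N. y (n + k) = X2 * x n + Y2 * y n + Z2 * z n" by blast
    have "\<forall>m\<le>2. \<bar>z (m + k)\<bar> \<le> c1 * c2 / sqrt (x k)"
      using z_near[of _ k] by (simp add: add.commute)
    from A[OF ret is_solution_xyz(3) this] obtain X3 Y3 Z3 where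
      3: "\<bar>Y3\<bar> \<le> A * (c1 * c2 / sqrt (x k))" "\<bar>Z3\<bar> \<le> A * (c1 * c2 / sqrt (x k))"
      "\<forall>n\<le>N. z (n + k) = X3 * x n + Y3 * y n + Z3 * z n" by blast
    have le1: "A * (c2\<^sup>2 * x k) \<le> B * x k"
      using mult_right_mono[OF B(1), of "x k"] x_pos[of k] by (simp add: mult.assoc)
    have le2: "A * (c1 * c2 / sqrt (x k)) \<le> B / sqrt (x k)"
      using divide_right_mono[OF B(2), of "sqrt (x k)"] x_pos[of k] by simp
    show ?thesis
      apply (rule exI[of _ X1], rule exI[of _ Y1], rule exI[of _ Z1])
      apply (rule exI[of _ X2], rule exI[of _ Y2], rule exI[of _ Z2])
      apply (rule exI[of _ X3], rule exI[of _ Y3], rule exI[of _ Z3])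
      using 1 2 3 le1 le2 by (meson order_trans)
  qed
  with \<open>B > 0\<close> have "coefficient_bound B" unfolding coefficient_bound_def by simp
  then show ?thesis ..
qed

text \<open>At the last index \<open>N\<close> every term other than \<open>X * x N\<close> is at
  most of order \<open>1 / sqrt (x k)\<close>; dividing by \<open>x N\<close> gains the extra
  factor.\<close>

lemma return_unstable_coefficient:
  assumes "returns k N" "\<bar>u (N + k)\<bar> \<le> c1 / sqrt (x (N + k))"
    and u: "u (N + k) = X * x N + Y * y N + Z * z N"
    and YZ: "\<bar>Y\<bar> \<le> B / sqrt (x k)" "\<bar>Z\<bar> \<le> B / sqrt (x k)"
  shows "\<bar>X\<bar> \<le> (c1 * sqrt (c2 ^ h) + 2 * B * c1) / (sqrt (x k) * x N)"
proof -
  let ?p = "sqrt (x k)"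
  have p: "?p > 0" using x_pos by simp
  have "c1 / sqrt (x n) \<le> c1" for n using sqrt_x_ge_1[of n] c1_pos by (simp add: divide_le_eq)
  then have yz: "\<bar>y N\<bar> \<le> c1" "\<bar>z N\<bar> \<le> c1" using y_bound[of N] z_bound[of N] order_trans by blast+
  \<comment> \<open>\<open>x\<close> need not be monotone, hence the factor \<open>c2 ^ h\<close>
    when the indices \<open>k\<close> and \<open>N + k\<close> are compared.\<close>
  have "?p \<le> sqrt (c2 ^ h) * sqrt (x (N + k))"
    using x_quasi_mono[of k N] by (simp add: add.commute flip: real_sqrt_mult)
  then have 1: "c1 / sqrt (x (N + k)) \<le> c1 * sqrt (c2 ^ h) / ?p"
    using p x_pos[of "N + k"] c1_pos by (simp add: field_simps)
  have 2: "\<bar>Y * y N\<bar> \<le> B / ?p * c1" "\<bar>Z * z N\<bar> \<le> B / ?p * c1"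
    unfolding abs_mult using YZ yz by (intro mult_mono; linarith)+
  have "\<bar>X\<bar> * x N = \<bar>u (N + k) - Y * y N - Z * z N\<bar>"
    using u x_pos[of N] by (simp add: abs_mult flip: abs_of_pos)
  also have "\<dots> \<le> c1 * sqrt (c2 ^ h) / ?p + B / ?p * c1 + B / ?p * c1"
    using assms(2) 1 2 by linarith
  also have "\<dots> = (c1 * sqrt (c2 ^ h) + 2 * B * c1) / ?p"
    by (simp add: add_divide_distrib algebra_simps)
  finally show ?thesis using p x_pos[of N] by (simp add: field_simps)
qed

text \<open>
  The determinant of the return map is bounded below while \<open>X2\<close> and \<open>X3\<close> are negligible, which forces
  \<open>X1\<close> to be of the order of \<open>x k\<close>.
\<close>

lemma return_growth:
  "\<exists>\<kappa>>0. \<exists>N0 n0. \<forall>k N n. returns k N \<longrightarrow> N0 \<le> N \<longrightarrow> n0 \<le> n \<longrightarrow> n \<le> N \<longrightarrow>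
     \<kappa> * x k * x n \<le> x (n + k)"
proof -
  obtain B where B: "coefficient_bound B" using coefficient_bound_exists ..
  then have "B > 0" by (simp add: coefficient_bound_def)
  define d where "d = \<bar>casoratian x y z 0\<bar>"
  have d: "d > 0" using casoratian_xyz_abs[of 0] by (simp add: d_def)
  define G where "G = c1 * sqrt (c2 ^ h) + 2 * B * c1"
  have G: "G > 0" using c1_pos c2_ge_1 \<open>B > 0\<close> by (simp add: G_def add_pos_pos)
  \<comment> \<open>Chosen so that
    \<open>1 / 2 \<le> \<bar>X1\<bar> * (2 * B\<^sup>2 * d) / x k\<close> becomes
    \<open>\<kappa> * x k \<le> \<bar>X1\<bar>\<close>.\<close>
  define \<kappa> where "\<kappa> = 1 / (4 * B\<^sup>2 * d)"
  have \<kappa>: "\<kappa> > 0" using \<open>B > 0\<close> d by (simp add: \<kappa>_def)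
  \<comment> \<open>\<open>N0\<close> makes the share of \<open>X2\<close> and \<open>X3\<close> in
    the determinant at most 1/2; \<open>n0\<close> makes the terms in \<open>Y1\<close> and
    \<open>Z1\<close> at most half of the main term.\<close>
  obtain N0 where N0: "\<And>n. n \<ge> N0 \<Longrightarrow> x n \<ge> 8 * B\<^sup>2 * G * d" using x_unbounded by metis
  obtain n0 where n0: "\<And>n. n \<ge> n0 \<Longrightarrow> x n \<ge> 4 * B * c1 / \<kappa>" using x_unbounded by metis
  \<comment> \<open>The \<open>+ 2\<close> places the indices 0, 1, 2 below \<open>N\<close>, so
    that the determinants at 0 and at \<open>k\<close> can be compared.\<close>
  have "\<kappa> / 2 * x k * x n \<le> x (n + k)"
    if ret: "returns k N" and N: "N0 + 2 \<le> N" and n: "n0 \<le> n" "n \<le> N" for k N n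
  proof -
    obtain X1 Y1 Z1 X2 Y2 Z2 X3 Y3 Z3 where
      b1: "\<bar>X1\<bar> \<le> B * x k" "\<bar>Y1\<bar> \<le> B * x k" "\<bar>Z1\<bar> \<le> B * x k" and
      b2: "\<bar>Y2\<bar> \<le> B / sqrt (x k)" "\<bar>Z2\<bar> \<le> B / sqrt (x k)" and
      b3: "\<bar>Y3\<bar> \<le> B / sqrt (x k)" "\<bar>Z3\<bar> \<le> B / sqrt (x k)" and
      eqs: "\<And>n. n \<le> N \<Longrightarrow> x (n + k) = X1 * x n + Y1 * y n + Z1 * z n"
           "\<And>n. n \<le> N \<Longrightarrow> y (n + k) = X2 * x n + Y2 * y n + Z2 * z n"
           "\<And>n. n \<le> N \<Longrightarrow> z (n + k) = X3 * x n + Y3 * y n + Z3 * z n"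
      by (rule coefficient_boundE[OF B ret]) blast
    let ?p = "sqrt (x k)"
    have p: "?p > 0" "?p * ?p = x k" using x_pos[of k] by simp_all
    have X2: "\<bar>X2\<bar> \<le> G / (?p * x N)" unfolding G_def
      using return_unstable_coefficient[of k N y, OF ret y_bound eqs(2)[OF order_refl] b2] by simp
    have X3: "\<bar>X3\<bar> \<le> G / (?p * x N)" unfolding G_def
      using return_unstable_coefficient[of k N z, OF ret z_bound eqs(3)[OF order_refl] b3] by simp
    have prod: "\<bar>s * t\<bar> \<le> S * T" if "\<bar>s\<bar> \<le> S" "\<bar>t\<bar> \<le> T" for s t S T :: real
      unfolding abs_mult using that by (intro mult_mono; linarith)
    \<comment> \<open>\<open>e\<close> equals \<open>B\<^sup>2 / x k\<close> and bounds products of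
      decaying coefficients; \<open>e'\<close> bounds products with \<open>X2\<close> or
      \<open>X3\<close> and carries a further factor \<open>1 / x N\<close>.\<close>
    define e where "e = B / ?p * (B / ?p)"
    define e' where "e' = G / (?p * x N) * (B / ?p)"
    have e: "\<bar>Y2 * Z3\<bar> \<le> e" "\<bar>Z2 * Y3\<bar> \<le> e" unfolding e_def by (intro prod b2 b3)+
    have e': "\<bar>X2 * Z3\<bar> \<le> e'" "\<bar>X3 * Z2\<bar> \<le> e'" "\<bar>X2 * Y3\<bar> \<le> e'" "\<bar>X3 * Y2\<bar> \<le> e'"
      unfolding e'_def by (intro prod b2 b3 X2 X3)+
    have "casoratian x y z k = (X1 * (Y2 * Z3 - Z2 * Y3) - Y1 * (X2 * Z3 - Z2 * X3)
        + Z1 * (X2 * Y3 - Y2 * X3)) * casoratian x y z 0"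
      using eqs N by (intro casoratian_lincomb) (simp_all add: add.commute[of k])
    then have "1 \<le> \<bar>X1 * (Y2 * Z3 - Z2 * Y3) - Y1 * (X2 * Z3 - Z2 * X3)
        + Z1 * (X2 * Y3 - Y2 * X3)\<bar> * d"
      using casoratian_xyz_abs[of k] by (simp add: d_def abs_mult)
    also have "\<dots> \<le> (\<bar>X1\<bar> * (2 * e) + B * x k * (2 * e') + B * x k * (2 * e')) * d"
    proof (rule mult_right_mono)
      have "\<bar>X1 * (Y2 * Z3 - Z2 * Y3)\<bar> \<le> \<bar>X1\<bar> * (2 * e)"
        by (rule prod) (use e in linarith)+
      moreover have "\<bar>Y1 * (X2 * Z3 - Z2 * X3)\<bar> \<le> B * x k * (2 * e')"
        by (rule prod) (use e' b1 in \<open>simp_all add: mult.commute[of Z2]\<close>)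
      moreover have "\<bar>Z1 * (X2 * Y3 - Y2 * X3)\<bar> \<le> B * x k * (2 * e')"
        by (rule prod) (use e' b1 in \<open>simp_all add: mult.commute[of Y2]\<close>)
      ultimately show "\<bar>X1 * (Y2 * Z3 - Z2 * Y3) - Y1 * (X2 * Z3 - Z2 * X3)
        + Z1 * (X2 * Y3 - Y2 * X3)\<bar> \<le> \<bar>X1\<bar> * (2 * e) + B * x k * (2 * e') + B * x k * (2 * e')"
        by linarith
    qed (use d in simp)
    also have "e = B\<^sup>2 / x k" using p by (simp add: e_def power2_eq_square)
    also have "e' = B * G / (x k * x N)"
    proof -
      have "e' = B * G / (?p * ?p * x N)" by (simp only: e'_def times_divide_times_eq ac_simps)
      then show ?thesis using p by simp
    qed
    also have "(\<bar>X1\<bar> * (2 * (B\<^sup>2 / x k)) + B * x k * (2 * (B * G / (x k * x N)))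
        + B * x k * (2 * (B * G / (x k * x N)))) * d
        = \<bar>X1\<bar> * (2 * B\<^sup>2 * d) / x k + 4 * B\<^sup>2 * G * d / x N"
      using x_pos[of k] x_pos[of N] by (simp add: field_simps power2_eq_square)
    finally have "1 \<le> \<bar>X1\<bar> * (2 * B\<^sup>2 * d) / x k + 4 * B\<^sup>2 * G * d / x N" .
    moreover have "4 * B\<^sup>2 * G * d / x N \<le> 1 / 2"
      using N0[of N] N x_pos[of N] by (simp add: field_simps)
    ultimately have "1 / 2 \<le> \<bar>X1\<bar> * (2 * B\<^sup>2 * d) / x k" by linarith
    then have X1: "\<kappa> * x k \<le> \<bar>X1\<bar>"
      using x_pos[of k] d \<open>B > 0\<close> by (simp add: \<kappa>_def field_simps)
    have "c1 / sqrt (x n) \<le> c1" using sqrt_x_ge_1[of n] c1_pos by (simp add: divide_le_eq)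
    then have yz: "\<bar>y n\<bar> \<le> c1" "\<bar>z n\<bar> \<le> c1"
      using y_bound[of n] z_bound[of n] by linarith+
    have "\<bar>X1\<bar> * x n = \<bar>x (n + k) - Y1 * y n - Z1 * z n\<bar>"
      using eqs(1)[OF n(2)] x_pos[of n] by (simp add: abs_mult flip: abs_of_pos)
    also have "\<dots> \<le> x (n + k) + B * x k * c1 + B * x k * c1"
      using prod[OF b1(2) yz(1)] prod[OF b1(3) yz(2)] x_pos[of "n + k"] by linarith
    finally have "\<kappa> * x k * x n \<le> x (n + k) + 2 * B * x k * c1"
      using mult_right_mono[OF X1 less_imp_le[OF x_pos[of n]]] by linarith
    moreover have "2 * B * x k * c1 \<le> \<kappa> / 2 * x k * x n"
    proof -
      have "2 * B * c1 \<le> \<kappa> / 2 * x n" using n0[OF n(1)] \<kappa> by (simp add: field_simps)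
      from mult_left_mono[OF this, of "x k"] x_pos[of k] show ?thesis
        by (simp add: algebra_simps)
    qed
    ultimately show ?thesis by (simp add: field_simps)
  qed
  then have "\<forall>k N n. returns k N \<longrightarrow> N0 + 2 \<le> N \<longrightarrow> n0 \<le> n \<longrightarrow> n \<le> N \<longrightarrow>
      \<kappa> / 2 * x k * x n \<le> x (n + k)" by blast
  moreover have "\<kappa> / 2 > 0" using \<kappa> by simp
  ultimately show ?thesis by blast
qed

section \<open>Return times with similar data\<close>

text \<open>The step from \<open>t j\<close> is a return valid up to \<open>t j + L\<close>. For
  \<open>n \<le> t i + L\<close> the index \<open>n + (t j - t i)\<close> stays in that range, so
  successive returns compose.\<close>

lemma return_chain:
  assumes "L \<ge> 3"
  shows "\<exists>t :: nat \<Rightarrow> nat. strict_mono t \<and> (\<forall>i. n0 \<le> t i) \<and>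
    (\<forall>i j. i \<le> j \<longrightarrow> returns (t j - t i) (t i + L))"
proof -
  have "\<forall>N. \<exists>k. k > 0 \<and> returns k (N + L)"
    using recurrent assms unfolding recurrent_from_3_def returns_def by simp
  then obtain f where f: "\<And>N. f N > 0" "\<And>N. returns (f N) (N + L)" by metis
  define t where "t = rec_nat n0 (\<lambda>_ N. N + f N)"
  have t_Suc: "t (Suc i) = t i + f (t i)" for i by (simp add: t_def)
  have mono: "strict_mono t" unfolding strict_mono_Suc_iff using f(1) t_Suc by simp
  have "t 0 = n0" by (simp add: t_def)
  then have "n0 \<le> t i" for i using strict_mono_mono[OF mono] by (metis monoD le0)
  moreover have "returns (t j - t i) (t i + L)" if "i \<le> j" for i j
    using that
  proof (induction j rule: dec_induct)
    case (step j)
    have le: "t i \<le> t j" using strict_mono_mono[OF mono] step.hyps by (simp add: monoD)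
    have "\<mu> n = \<mu> (n + (t (Suc j) - t i))" if n: "3 \<le> n" "n \<le> t i + L" for n
    proof -
      have "\<mu> n = \<mu> (n + (t j - t i))" using step.IH n by (simp add: returns_def)
      also have "\<dots> = \<mu> (n + (t j - t i) + f (t j))"
        using f(2)[of "t j", unfolded returns_def, rule_format, of "n + (t j - t i)"] n le by linarith
      also have "n + (t j - t i) + f (t j) = n + (t (Suc j) - t i)" using le by (simp add: t_Suc)
      finally show ?thesis .
    qed
    then show ?case by (simp add: returns_def)
  qed (simp add: returns_def)
  ultimately show ?thesis using mono by blast
qed

text \<open>Pigeonhole on a finite colouring: three floors at scale \<eta> and nine residues modulo
  \<open>D\<close>.\<close>

lemma similar_times:
  fixes t :: "nat \<Rightarrow> nat" and D :: int
  assumes "strict_mono t" "\<eta> > 0" "D > 0"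
  shows "\<exists>i j. i \<le> j \<and> t i + l \<le> t j \<and> (\<forall>m\<le>2.
    \<bar>sqrt (x (t j)) * y (t j + m) - sqrt (x (t i)) * y (t i + m)\<bar> \<le> \<eta> \<and>
    [q (t j + m) = q (t i + m)] (mod D) \<and> [r (t j + m) = r (t i + m)] (mod D) \<and>
    [s (t j + m) = s (t i + m)] (mod D))"
proof -
  \<comment> \<open>The normalising factor is the same for \<open>m = 0, 1, 2\<close>, so closeness
    is a statement about one multiple of the column \<open>y\<close>.\<close>
  define F where "F i m = \<lfloor>sqrt (x (t i)) * y (t i + m) / \<eta>\<rfloor>" for i m
  define col where "col i = map (F i) [0, 1, 2] @ map (\<lambda>m. q (t i + m) mod D) [0, 1, 2]
    @ map (\<lambda>m. r (t i + m) mod D) [0, 1, 2] @ map (\<lambda>m. s (t i + m) mod D) [0, 1, 2]" for i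
  define B where "B = \<lceil>c1 * c2 / \<eta>\<rceil> + 1 + D"
  have ceil: "0 \<le> \<lceil>c1 * c2 / \<eta>\<rceil>"
    using c1_pos c2_ge_1 \<open>\<eta> > 0\<close> by (simp add: less_le_trans[of "-1" 0])
  have residue: "v mod D \<in> {- B..B}" for v
    using pos_mod_bound[OF \<open>D > 0\<close>, of v] pos_mod_sign[OF \<open>D > 0\<close>, of v] \<open>D > 0\<close> ceil
    unfolding B_def atLeastAtMost_iff by linarith
  have F: "F i m \<in> {- B..B}" if "m \<le> 2" for i m
  proof -
    have "\<bar>sqrt (x (t i)) * y (t i + m) / \<eta>\<bar> \<le> c1 * c2 / \<eta>"
      using y_near[OF that, of "t i"] x_pos[of "t i"] \<open>\<eta> > 0\<close>
      by (simp add: abs_mult abs_divide field_simps)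
    then show ?thesis using \<open>D > 0\<close> unfolding F_def B_def atLeastAtMost_iff by linarith
  qed
  have "range col \<subseteq> {xs. set xs \<subseteq> {- B..B} \<and> length xs = 12}"
    using F residue by (auto simp: col_def)
  then have "finite (range col)"
    using finite_lists_length_eq[of "{- B..B}" 12] finite_subset by blast
  then obtain i where i: "infinite {j \<in> UNIV. col j = col i}"
    using pigeonhole_infinite[of UNIV col] by auto
  \<comment> \<open>Infinitely many indices share the colour of \<open>i\<close>, so
    \<open>j\<close> can be so large that \<open>j \<le> t j\<close> forces
    \<open>t i + l \<le> t j\<close>.\<close>
  then obtain j where j: "j > i + t i + l" "col j = col i"
    unfolding infinite_nat_iff_unbounded by blast
  have "j \<le> t j" using strict_mono_imp_increasing[OF assms(1)] .
  have eq: "F j m = F i m" "q (t j + m) mod D = q (t i + m) mod D"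
    "r (t j + m) mod D = r (t i + m) mod D" "s (t j + m) mod D = s (t i + m) mod D"
    if "m \<le> 2" for m
    using that j(2) by (auto simp: col_def numeral_2_eq_2 le_Suc_eq)
  have "\<bar>sqrt (x (t j)) * y (t j + m) - sqrt (x (t i)) * y (t i + m)\<bar> \<le> \<eta>" if "m \<le> 2" for m
  proof -
    have "\<bar>sqrt (x (t j)) * y (t j + m) / \<eta> - sqrt (x (t i)) * y (t i + m) / \<eta>\<bar> \<le> 1"
      using eq(1)[OF that] unfolding F_def by linarith
    then show ?thesis using \<open>\<eta> > 0\<close> by (simp flip: diff_divide_distrib add: abs_divide)
  qed
  then show ?thesis using j \<open>j \<le> t j\<close> eq
    by (intro exI[of _ i] exI[of _ j]) (auto simp: cong_def)
qed

section \<open>Integral approximants from the return map\<close>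

text \<open>The growth of \<open>x\<close> cancels against the two factors
  \<open>1 / sqrt x\<close>. Boundedness makes all these determinants divide a single
  factorial.\<close>

lemma casoratian_qrs_bounded: "\<exists>M. \<forall>n. nat \<bar>casoratian q r s n\<bar> \<le> M"
proof -
  have "nat \<bar>casoratian q r s n\<bar> \<le> nat \<lceil>6 * c2\<^sup>2 * (c1 * c2)\<^sup>2\<rceil>" for n
  proof -
    have "\<bar>casoratian x y z n\<bar> \<le> 6 * (c2\<^sup>2 * x n) * (c1 * c2 / sqrt (x n)) * (c1 * c2 / sqrt (x n))"
      using x_near_le x_pos by (intro casoratian_bound y_near z_near) (simp_all add: abs_of_pos)
    also have "\<dots> = 6 * c2\<^sup>2 * (c1 * c2)\<^sup>2"
      using x_pos[of n] by (simp add: field_simps power2_eq_square)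
    finally show ?thesis unfolding casoratian_xyz by linarith
  qed
  then show ?thesis by blast
qed

text \<open>
  As \<open>(0, 0, 1)\<close> has coordinates \<open>(x, y, z) = (0, 0, -1)\<close>, the number \<open>- Z\<close> is the value at \<open>(0, 0, 1)\<close>
  of the functional that takes \<open>(q m, r m, s m)\<close> to \<open>v (m + k)\<close>.
\<close>

lemma third_coefficient_integral:
  assumes v: "\<And>m. m \<le> 2 \<Longrightarrow>
      of_int (v (n + m + k)) = X * x (n + m) + Y * y (n + m) + Z * z (n + m)"
    and cong: "\<And>m. m \<le> 2 \<Longrightarrow> [v (n + m + k) = v (n + m)] (mod D * casoratian q r s n)"
    and init: "casoratian q r v n = \<delta> * casoratian q r s n"
  shows "\<exists>w. - Z = of_int w \<and> D dvd w - \<delta>"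
proof -
  define \<Delta> where "\<Delta> = casoratian q r s n"
  have "\<Delta> \<noteq> 0" using det_nonzero by (simp add: \<Delta>_def)
  let ?v = "\<lambda>n. v (n + k)"
  have "D * \<Delta> dvd ?v (n + m) - v (n + m)" if "m \<le> 2" for m
    using cong[OF that] by (simp add: \<Delta>_def cong_iff_dvd_diff)
  note dvd = this[of 0] this[of 1] this[of 2]
  \<comment> \<open>The determinant is linear in its third column; expansion along it leaves integer
    cofactors.\<close>
  have "casoratian q r ?v n - casoratian q r v n =
      (?v (n + 0) - v (n + 0)) * (q (n + 2) * r (n + 1) - q (n + 1) * r (n + 2))
    + (?v (n + 1) - v (n + 1)) * (q n * r (n + 2) - q (n + 2) * r n)
    + (?v (n + 2) - v (n + 2)) * (q (n + 1) * r n - q n * r (n + 1))"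
    by (simp add: casoratian_def algebra_simps)
  also have "D * \<Delta> dvd \<dots>" using dvd by (intro dvd_add dvd_mult2) auto
  finally obtain w where w: "casoratian q r ?v n = \<delta> * \<Delta> + D * \<Delta> * w"
    unfolding init \<Delta>_def[symmetric] dvd_def by (auto simp: algebra_simps)
  have "casoratian x y (\<lambda>n. of_int (?v n)) n = Z * casoratian x y z n"
    using v by (rule casoratian_cramer)
  \<comment> \<open>The sign comes from the single \<open>- r\<close> in \<open>y\<close>.\<close>
  moreover have "casoratian x y (\<lambda>n. of_int (?v n)) n = - of_int (casoratian q r ?v n)"
    by (simp add: casoratian_def x_def y_def algebra_simps)
  ultimately have "- Z * of_int \<Delta> = of_int (\<delta> + D * w) * of_int \<Delta>"
    unfolding casoratian_xyz w \<Delta>_def[symmetric] by (simp add: algebra_simps)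
  then have "- Z = of_int (\<delta> + D * w)" using \<open>\<Delta> \<noteq> 0\<close> by (simp only: mult_cancel_right) simp
  then show ?thesis by (intro exI[of _ "\<delta> + D * w"]) simp
qed

lemma x_eventually_greater: "\<exists>l. \<forall>k\<ge>l. x k > B"
  using x_unbounded[of "B + 1"] by (meson less_add_one less_le_trans)

text \<open>The image of \<open>(0, 0, 1)\<close> has \<open>Q = - Z1\<close> and errors
  \<open>- Z2\<close>, \<open>- Z3\<close>. Hence \<open>C = sqrt B * B\<close>, and only the
  smallness of \<open>Z2\<close> needs the similar times.\<close>

lemma approximants_of_unit_vector:
  "\<exists>C>0. \<forall>\<epsilon>>0. \<forall>D\<ge>2. \<exists>Q R S :: int. Q \<noteq> 0 \<and> D dvd Q \<and> D dvd R \<and> D dvd S - 1 \<and>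
     sqrt \<bar>of_int Q\<bar> * \<bar>of_int Q * \<alpha> - of_int R\<bar> \<le> \<epsilon> \<and>
     sqrt \<bar>of_int Q\<bar> * \<bar>of_int Q * \<beta> - of_int S\<bar> \<le> C"
proof -
  obtain B where B: "coefficient_bound B" using coefficient_bound_exists ..
  then have "B > 0" by (simp add: coefficient_bound_def)
  obtain \<kappa> N0 n0 where "\<kappa> > 0" and growth: "\<And>k N n. returns k N \<Longrightarrow> N0 \<le> N \<Longrightarrow>
      n0 \<le> n \<Longrightarrow> n \<le> N \<Longrightarrow> \<kappa> * x k * x n \<le> x (n + k)"
    using return_growth by blast
  obtain M where M: "\<And>n. nat \<bar>casoratian q r s n\<bar> \<le> M" using casoratian_qrs_bounded by blast
  obtain t :: "nat \<Rightarrow> nat" where t: "strict_mono t" "\<And>i. n0 \<le> t i"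
      "\<And>i j. i \<le> j \<Longrightarrow> returns (t j - t i) (t i + (N0 + 3))"
    using return_chain[OF le_add2[of 3 N0], of n0] by blast
  have "\<exists>Q R S :: int. Q \<noteq> 0 \<and> D dvd Q \<and> D dvd R \<and> D dvd S - 1 \<and>
     sqrt \<bar>of_int Q\<bar> * \<bar>of_int Q * \<alpha> - of_int R\<bar> \<le> \<epsilon> \<and>
     sqrt \<bar>of_int Q\<bar> * \<bar>of_int Q * \<beta> - of_int S\<bar> \<le> sqrt B * B"
    if "\<epsilon> > 0" "D \<ge> 2" for \<epsilon> :: real and D :: int
  proof -
    define \<epsilon>' where "\<epsilon>' = min 1 (\<epsilon> / sqrt B)"
    have \<epsilon>': "\<epsilon>' > 0" "\<epsilon>' \<le> 1" "sqrt B * \<epsilon>' \<le> \<epsilon>"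
      using \<open>\<epsilon> > 0\<close> \<open>B > 0\<close> by (auto simp: \<epsilon>'_def min_def field_simps)
    \<comment> \<open>Tuned so that the determinant bound for \<open>Z2\<close> comes out as
      \<open>\<epsilon>' / sqrt (x k)\<close>.\<close>
    define \<eta> where "\<eta> = \<epsilon>' * sqrt \<kappa> / (6 * c2\<^sup>2 * (c1 * c2))"
    have "\<eta> > 0" using \<epsilon>' \<open>\<kappa> > 0\<close> c1_pos c2_ge_1 by (simp add: \<eta>_def)
    obtain l where l: "\<And>k. k \<ge> l \<Longrightarrow> x k > max 1 (B\<^sup>2)" using x_eventually_greater by blast
    \<comment> \<open>The modulus has to be fixed before \<open>n\<close> is known;
      \<open>fact M\<close> is a multiple of the determinant at every index.\<close>
    have "D * fact M > 0" using that by simp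
    from similar_times[OF t(1) \<open>\<eta> > 0\<close> this, of l] obtain i j where
      "i \<le> j" "t i + l \<le> t j" and sim: "\<And>m. m \<le> 2 \<Longrightarrow>
        \<bar>sqrt (x (t j)) * y (t j + m) - sqrt (x (t i)) * y (t i + m)\<bar> \<le> \<eta> \<and>
        [q (t j + m) = q (t i + m)] (mod (D * fact M)) \<and>
        [r (t j + m) = r (t i + m)] (mod (D * fact M)) \<and>
        [s (t j + m) = s (t i + m)] (mod (D * fact M))"
      by blast
    define n where "n = t i"
    define k where "k = t j - t i"
    define N where "N = n + (N0 + 3)"
    have nk: "t j = n + k" "k \<ge> l" using \<open>t i + l \<le> t j\<close> by (simp_all add: n_def k_def)
    have ret: "returns k N" using t(3)[OF \<open>i \<le> j\<close>] by (simp add: k_def N_def n_def)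
    have xnk: "\<kappa> * x k * x n \<le> x (n + k)"
      by (rule growth[OF ret]) (use t(2)[of i] in \<open>auto simp: N_def n_def\<close>)
    have xk: "x k > 1" "sqrt (x k) > B" using l[OF nk(2)] \<open>B > 0\<close> by (auto intro: real_less_rsqrt)
    have dvd: "D * casoratian q r s n dvd D * fact M"
    proof -
      have "1 \<le> nat \<bar>casoratian q r s n\<bar>" using det_nonzero[of n] by simp
      then have "nat \<bar>casoratian q r s n\<bar> dvd fact M" using M by (rule dvd_fact)
      then have "int (nat \<bar>casoratian q r s n\<bar>) dvd int (fact M)" by (simp only: int_dvd_int_iff)
      then show ?thesis by (intro mult_dvd_mono) simp_all
    qed
    have cong: "[q (n + m + k) = q (n + m)] (mod (D * casoratian q r s n))"
      "[r (n + m + k) = r (n + m)] (mod (D * casoratian q r s n))"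
      "[s (n + m + k) = s (n + m)] (mod (D * casoratian q r s n))" if "m \<le> 2" for m
      using sim[OF that] cong_dvd_modulus[OF _ dvd] unfolding nk n_def[symmetric]
      by (simp_all add: add.assoc add.commute[of k])
    obtain X1 Y1 Z1 X2 Y2 Z2 X3 Y3 Z3 where
      b: "\<bar>Z1\<bar> \<le> B * x k" "\<bar>Z3\<bar> \<le> B / sqrt (x k)" and
      eqs: "\<And>n. n \<le> N \<Longrightarrow> x (n + k) = X1 * x n + Y1 * y n + Z1 * z n"
           "\<And>n. n \<le> N \<Longrightarrow> y (n + k) = X2 * x n + Y2 * y n + Z2 * z n"
           "\<And>n. n \<le> N \<Longrightarrow> z (n + k) = X3 * x n + Y3 * y n + Z3 * z n"
      by (rule coefficient_boundE[OF B ret]) blast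
    have le_N: "n + m \<le> N" if "m \<le> 2" for m using that by (simp add: N_def)
    have Z2: "\<bar>Z2\<bar> \<le> \<epsilon>' / sqrt (x k)"
    proof -
      \<comment> \<open>Subtracting \<open>\<rho> * y\<close> leaves the coefficient of
        \<open>z\<close> unchanged and turns closeness of the normalised errors into a small column
        \<delta>.\<close>
      define \<rho> where "\<rho> = sqrt (x n) / sqrt (x (n + k))"
      define \<delta> where "\<delta> m = y (m + k) - \<rho> * y m" for m
      have \<delta>: "\<bar>\<delta> (n + m)\<bar> \<le> \<eta> / sqrt (x (n + k))" if "m \<le> 2" for m
      proof -
        have "\<bar>sqrt (x (n + k)) * y (n + m + k) - sqrt (x n) * y (n + m)\<bar> \<le> \<eta>"
          using sim[OF that] unfolding nk n_def[symmetric]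
          by (simp add: add.assoc add.commute[of k])
        moreover have "\<delta> (n + m) =
            (sqrt (x (n + k)) * y (n + m + k) - sqrt (x n) * y (n + m)) / sqrt (x (n + k))"
          using x_pos[of "n + k"] by (simp add: \<delta>_def \<rho>_def diff_divide_distrib)
        ultimately show ?thesis
          using x_pos[of "n + k"] by (simp add: abs_divide divide_right_mono)
      qed
      have "casoratian x y \<delta> n = Z2 * casoratian x y z n"
      proof (rule casoratian_cramer)
        show "\<delta> (n + m) = X2 * x (n + m) + (Y2 - \<rho>) * y (n + m) + Z2 * z (n + m)"
          if "m \<le> 2" for m
          unfolding \<delta>_def eqs(2)[OF le_N[OF that]] by (simp add: algebra_simps)
      qed
      moreover have "\<bar>Z2\<bar> * 1 \<le> \<bar>Z2\<bar> * \<bar>casoratian x y z n\<bar>"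
        by (intro mult_left_mono casoratian_xyz_abs) simp
      ultimately have "\<bar>Z2\<bar> \<le> \<bar>casoratian x y \<delta> n\<bar>" by (simp add: abs_mult)
      also have "\<dots> \<le> 6 * (c2\<^sup>2 * x n) * (c1 * c2 / sqrt (x n)) * (\<eta> / sqrt (x (n + k)))"
        using x_near_le x_pos by (intro casoratian_bound y_near \<delta>) (simp_all add: abs_of_pos)
      also have "\<dots> = \<epsilon>' * sqrt (\<kappa> * x n) / sqrt (x (n + k))"
      proof -
        have "6 * (c2\<^sup>2 * x n) * (c1 * c2 / sqrt (x n)) * (\<eta> / sqrt (x (n + k)))
            = 6 * c2\<^sup>2 * (c1 * c2) * \<eta> * (x n / sqrt (x n)) / sqrt (x (n + k))"
          by simp
        also have "x n / sqrt (x n) = sqrt (x n)" using x_pos[of n] by (simp add: real_div_sqrt)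
        also have "6 * c2\<^sup>2 * (c1 * c2) * \<eta> = \<epsilon>' * sqrt \<kappa>"
          using c1_pos c2_ge_1 by (simp add: \<eta>_def)
        finally show ?thesis by (simp add: real_sqrt_mult)
      qed
      \<comment> \<open>Here the lower bound \<open>\<kappa> * x k * x n \<le> x (n + k)\<close>
        replaces the index \<open>n + k\<close> by \<open>k\<close>.\<close>
      also have "\<dots> \<le> \<epsilon>' / sqrt (x k)"
      proof -
        have "sqrt (\<kappa> * x n) * sqrt (x k) \<le> sqrt (x (n + k))"
          using xnk by (simp add: ac_simps flip: real_sqrt_mult)
        from mult_left_mono[OF this, of \<epsilon>'] show ?thesis
          using \<epsilon>' x_pos[of k] x_pos[of "n + k"] by (simp add: field_simps)
      qed
      finally show ?thesis by simp
    qed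
    \<comment> \<open>A repeated column gives \<open>\<delta> = 0\<close> for \<open>q\<close>, and
      likewise for \<open>r\<close> below; for \<open>s\<close> the value is 1.\<close>
    have "casoratian q r q n = 0 * casoratian q r s n" by (simp add: casoratian_def algebra_simps)
    then have "\<exists>w. - Z1 = of_int w \<and> D dvd w - 0"
    proof (rule third_coefficient_integral[rotated 2])
      show "of_int (q (n + m + k)) = X1 * x (n + m) + Y1 * y (n + m) + Z1 * z (n + m)"
        if "m \<le> 2" for m
        using eqs(1)[OF le_N[OF that]] unfolding x_def[of "n + m + k"] .
    qed (rule cong)
    then obtain Q where Q: "- Z1 = of_int Q" "D dvd Q" by auto
    have "casoratian q r r n = 0 * casoratian q r s n" by (simp add: casoratian_def algebra_simps)
    then have "\<exists>w. - (\<alpha> * Z1 - Z2) = of_int w \<and> D dvd w - 0"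
    proof (rule third_coefficient_integral[rotated 2])
      show "of_int (r (n + m + k)) = (\<alpha> * X1 - X2) * x (n + m) + (\<alpha> * Y1 - Y2) * y (n + m)
          + (\<alpha> * Z1 - Z2) * z (n + m)" if "m \<le> 2" for m
      proof -
        have "of_int (r (n + m + k)) = \<alpha> * x (n + m + k) - y (n + m + k)"
          by (simp add: x_def y_def)
        then show ?thesis unfolding eqs(1,2)[OF le_N[OF that]] by (simp add: algebra_simps)
      qed
    qed (rule cong)
    then obtain R where R: "- (\<alpha> * Z1 - Z2) = of_int R" "D dvd R" by auto
    have "casoratian q r s n = 1 * casoratian q r s n" by simp
    then have "\<exists>w. - (\<beta> * Z1 - Z3) = of_int w \<and> D dvd w - 1"
    proof (rule third_coefficient_integral[rotated 2])
      show "of_int (s (n + m + k)) = (\<beta> * X1 - X3) * x (n + m) + (\<beta> * Y1 - Y3) * y (n + m)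
          + (\<beta> * Z1 - Z3) * z (n + m)" if "m \<le> 2" for m
      proof -
        have "of_int (s (n + m + k)) = \<beta> * x (n + m + k) - z (n + m + k)"
          by (simp add: x_def z_def)
        then show ?thesis unfolding eqs(1,3)[OF le_N[OF that]] by (simp add: algebra_simps)
      qed
    qed (rule cong)
    then obtain S where S: "- (\<beta> * Z1 - Z3) = of_int S" "D dvd S - 1" by auto
    have \<alpha>: "of_int Q * \<alpha> - of_int R = - Z2" unfolding Q(1)[symmetric] R(1)[symmetric]
      by (simp add: algebra_simps)
    have \<beta>: "of_int Q * \<beta> - of_int S = - Z3" unfolding Q(1)[symmetric] S(1)[symmetric]
      by (simp add: algebra_simps)
    have "Q \<noteq> 0"
    proof
      \<comment> \<open>Then \<open>\<bar>S\<bar> = \<bar>Z3\<bar> < 1\<close> by the choice of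
        \<open>l\<close>, so \<open>S = 0\<close>, against \<open>S\<close> being 1 modulo
        \<open>D \<ge> 2\<close>.\<close>
      assume "Q = 0"
      have "B / sqrt (x k) < 1" using xk(1,2) by simp
      then have "\<bar>of_int S :: real\<bar> < 1" using \<beta> b(2) \<open>Q = 0\<close> by simp
      then have "S = 0" by linarith
      with S(2) that(2) show False by (simp add: zdvd_not_zless)
    qed
    have sqrtQ: "sqrt \<bar>of_int Q\<bar> \<le> sqrt B * sqrt (x k)"
      using b(1) unfolding Q(1)[symmetric] by (simp flip: real_sqrt_mult)
    have *: "sqrt \<bar>of_int Q\<bar> * \<bar>- Z\<bar> \<le> sqrt B * e" if "\<bar>Z\<bar> \<le> e / sqrt (x k)" for Z e
    proof -
      have "sqrt \<bar>of_int Q\<bar> * \<bar>- Z\<bar> \<le> sqrt B * sqrt (x k) * (e / sqrt (x k))"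
        using that sqrtQ x_pos[of k] \<open>B > 0\<close> by (intro mult_mono) auto
      then show ?thesis using x_pos[of k] by simp
    qed
    show ?thesis
      using \<open>Q \<noteq> 0\<close> Q(2) R(2) S(2) *[OF Z2] *[OF b(2)] \<epsilon>'(3) unfolding \<alpha>[symmetric] \<beta>[symmetric]
      by (intro exI[of _ Q] exI[of _ R] exI[of _ S]) auto
  qed
  moreover have "sqrt B * B > 0" using \<open>B > 0\<close> by simp
  ultimately show ?thesis by blast
qed

end

section \<open>Passage to primitive triples\<close>

text \<open>A common divisor of \<open>D\<close> and the gcd divides both \<open>S\<close> and
  \<open>S - 1\<close>, so division by the gcd keeps the divisibility by \<open>D\<close>.\<close>

lemma primitive_part_of_approximant:
  fixes Q R S D :: int and \<alpha> \<beta> :: real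
  assumes "Q \<noteq> 0" "D dvd Q" "D dvd R" "D dvd S - 1"
    and \<alpha>: "sqrt \<bar>of_int Q\<bar> * \<bar>of_int Q * \<alpha> - of_int R\<bar> \<le> \<epsilon>"
    and \<beta>: "sqrt \<bar>of_int Q\<bar> * \<bar>of_int Q * \<beta> - of_int S\<bar> \<le> C"
  shows "\<exists>Q R S :: int. Q > 0 \<and> Gcd {Q, R, S} = 1 \<and> D dvd Q \<and> D dvd R \<and>
     sqrt (of_int Q) * \<bar>of_int Q * \<alpha> - of_int R\<bar> \<le> \<epsilon> \<and>
     sqrt (of_int Q) * \<bar>of_int Q * \<beta> - of_int S\<bar> \<le> C"
proof -
  define G where "G = Gcd {Q, R, S}"
  \<comment> \<open>The sign makes the new denominator positive.\<close>
  define g where "g = sgn Q * G"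
  have "G dvd Q" "G dvd R" "G dvd S" unfolding G_def by (rule Gcd_dvd, simp)+
  moreover have "G \<noteq> 0" using \<open>G dvd Q\<close> \<open>Q \<noteq> 0\<close> by auto
  then have G: "G > 0" using Gcd_int_greater_eq_0[of "{Q, R, S}"] unfolding G_def by linarith
  ultimately have g: "g \<noteq> 0" "g dvd Q" "g dvd R" "g dvd S" "\<bar>g\<bar> \<ge> 1" "\<bar>g\<bar> = G"
    using \<open>Q \<noteq> 0\<close> by (auto simp: g_def sgn_if)
  obtain Q' R' S' where eq: "Q = g * Q'" "R = g * R'" "S = g * S'"
    using g(2-4) unfolding dvd_def by blast
  have "\<bar>Q\<bar> = G * Q'"
  proof (cases "Q > 0")
    case True
    then have "g = G" by (simp add: g_def)
    then show ?thesis using eq(1) True by simp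
  next
    case False
    then have "g = - G" using \<open>Q \<noteq> 0\<close> by (simp add: g_def sgn_if)
    then show ?thesis using eq(1) False by simp
  qed
  then have "Q' > 0" using \<open>Q \<noteq> 0\<close> G by (metis zero_less_abs_iff zero_less_mult_pos)
  moreover have "Gcd {Q', R', S'} = 1"
  proof -
    have "\<bar>g\<bar> = \<bar>g\<bar> * Gcd {Q', R', S'}"
      using g(6) Gcd_mult[of g "{Q', R', S'}"] unfolding G_def by (simp add: eq abs_mult)
    then show ?thesis using g(1) by simp
  qed
  moreover have "coprime D g"
  proof (rule coprimeI)
    fix c assume c: "c dvd D" "c dvd g"
    then have "c dvd S" "c dvd S - 1" using g(4) assms(4) dvd_trans by blast+
    then have "c dvd S - (S - 1)" by (rule dvd_diff)
    then show "is_unit c" by simp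
  qed
  then have "D dvd Q'" "D dvd R'"
    using assms(2,3) by (simp_all add: eq coprime_dvd_mult_right_iff)
  moreover have "sqrt (of_int Q') * \<bar>of_int Q' * \<gamma> - of_int T'\<bar> \<le> e"
    if "sqrt \<bar>of_int Q\<bar> * \<bar>of_int Q * \<gamma> - of_int (g * T')\<bar> \<le> e" for \<gamma> T' e
  proof -
    have g1: "(1::real) \<le> \<bar>of_int g\<bar>" using g(5) by linarith
    \<comment> \<open>Division by \<open>g\<close> shrinks the normalised error by the factor
      \<open>\<bar>g\<bar>\<close> to the power 3/2, which is at least 1.\<close>
    have "1 * (sqrt (of_int Q') * \<bar>of_int Q' * \<gamma> - of_int T'\<bar>)
       \<le> (sqrt \<bar>of_int g\<bar> * \<bar>of_int g\<bar>) * (sqrt (of_int Q') * \<bar>of_int Q' * \<gamma> - of_int T'\<bar>)"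
      using g1 \<open>Q' > 0\<close> mult_mono[of 1 "sqrt \<bar>of_int g\<bar>" 1 "\<bar>of_int g\<bar>"]
      by (intro mult_right_mono) auto
    also have "\<dots> = sqrt \<bar>of_int Q\<bar> * \<bar>of_int Q * \<gamma> - of_int (g * T')\<bar>"
    proof -
      have "of_int Q * \<gamma> - of_int (g * T') = of_int g * (of_int Q' * \<gamma> - of_int T')"
        by (simp add: eq algebra_simps)
      then show ?thesis using \<open>Q' > 0\<close> by (simp add: eq abs_mult real_sqrt_mult)
    qed
    finally show ?thesis using that by simp
  qed
  ultimately show ?thesis using \<alpha> \<beta> unfolding eq(2,3) by blast
qed

lemma (in approximation_sequence) primitive_approximants:
  "\<exists>C>0. \<forall>\<epsilon>>0. \<forall>D\<ge>1. \<exists>Q R S :: int. Q > 0 \<and> Gcd {Q, R, S} = 1 \<and> D dvd Q \<and> D dvd R \<and>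
     sqrt (of_int Q) * \<bar>of_int Q * \<alpha> - of_int R\<bar> \<le> \<epsilon> \<and>
     sqrt (of_int Q) * \<bar>of_int Q * \<beta> - of_int S\<bar> \<le> C"
proof -
  obtain C where "C > 0" and C: "\<And>\<epsilon> D. \<epsilon> > 0 \<Longrightarrow> D \<ge> 2 \<Longrightarrow> \<exists>Q R S :: int. Q \<noteq> 0 \<and>
     D dvd Q \<and> D dvd R \<and> D dvd S - 1 \<and>
     sqrt \<bar>of_int Q\<bar> * \<bar>of_int Q * \<alpha> - of_int R\<bar> \<le> \<epsilon> \<and>
     sqrt \<bar>of_int Q\<bar> * \<bar>of_int Q * \<beta> - of_int S\<bar> \<le> C"
    using approximants_of_unit_vector by blast
  have "\<exists>Q R S :: int. Q > 0 \<and> Gcd {Q, R, S} = 1 \<and> D dvd Q \<and> D dvd R \<and>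
     sqrt (of_int Q) * \<bar>of_int Q * \<alpha> - of_int R\<bar> \<le> \<epsilon> \<and>
     sqrt (of_int Q) * \<bar>of_int Q * \<beta> - of_int S\<bar> \<le> C" if "\<epsilon> > 0" "D \<ge> 1" for \<epsilon> :: real and D :: int
  proof -
    \<comment> \<open>Doubling gives a modulus of at least 2 also when \<open>D = 1\<close>.\<close>
    from C[of \<epsilon> "2 * D"] that obtain Q R S :: int where QRS: "Q \<noteq> 0" "2 * D dvd Q" "2 * D dvd R"
      "2 * D dvd S - 1" "sqrt \<bar>of_int Q\<bar> * \<bar>of_int Q * \<alpha> - of_int R\<bar> \<le> \<epsilon>"
      "sqrt \<bar>of_int Q\<bar> * \<bar>of_int Q * \<beta> - of_int S\<bar> \<le> C"
      by auto
    show ?thesis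
      by (rule primitive_part_of_approximant[OF QRS(1) QRS(2-4)[THEN dvd_mult_right] QRS(5,6)])
  qed
  with \<open>C > 0\<close> show ?thesis by blast
qed

section \<open>From the hypotheses on the sequence to the two approximation statements\<close>

lemma approximation_sequenceI:
  assumes "good_approximation_sequence \<alpha> \<beta> q r s" "recurrence_coefficients q r s \<mu>"
    "recurrent_from_3 \<mu>"
  shows "\<exists>c1 c2 K h. approximation_sequence \<alpha> \<beta> q r s \<mu> c1 c2 K h"
proof -
  from assms(1) obtain c1 c2 K :: real and h :: nat where
    *: "\<And>n. q n > 0" "c1 > 0" "c2 \<ge> 1" "h > 0" "K > 1"
    "\<And>n. sqrt (of_int (q n)) * \<bar>of_int (q n) * \<alpha> - of_int (r n)\<bar> \<le> c1"
    "\<And>n. sqrt (of_int (q n)) * \<bar>of_int (q n) * \<beta> - of_int (s n)\<bar> \<le> c1"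
    and c2: "\<And>n. n \<ge> 1 \<Longrightarrow> inverse c2 * of_int (q (n - 1)) \<le> real_of_int (q n)"
    "\<And>n. n \<ge> 1 \<Longrightarrow> of_int (q n) \<le> c2 * of_int (q (n - 1))"
    and K: "\<And>n. of_int (q (n + h)) \<ge> K * of_int (q n)"
    and det: "\<And>n. n \<ge> 2 \<Longrightarrow> consecutive_det q r s n \<noteq> 0"
    unfolding good_approximation_sequence_def by blast
  have "approximation_sequence \<alpha> \<beta> q r s \<mu> c1 c2 K h"
  proof
    show "of_int (q n) \<le> c2 * of_int (q (Suc n))" for n
      using c2(1)[of "Suc n"] \<open>c2 \<ge> 1\<close> by (simp add: field_simps)
    show "of_int (q (Suc n)) \<le> c2 * of_int (q n)" for n
      using c2(2)[of "Suc n"] by simp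
    show "casoratian q r s n \<noteq> 0" for n
      using det[of "n + 2"] by (simp only: consecutive_det_eq_casoratian) simp
  qed (use * K assms in auto)
  then show ?thesis by blast
qed

lemma powr_minus_half_bound:
  assumes "Q > 0" "sqrt Q * u \<le> e"
  shows "u \<le> e * Q powr (- 1 / 2)"
  using assms by (simp add: powr_minus powr_half_sqrt[symmetric] field_simps)

theorem theorem1p3:
  fixes \<alpha> \<beta> :: real
  assumes "simultaneously_badly_approximable \<alpha> \<beta>"
  shows "\<exists>C>0. \<forall>(q :: nat \<Rightarrow> int) (r :: nat \<Rightarrow> int) (s :: nat \<Rightarrow> int) \<mu>.
    good_approximation_sequence \<alpha> \<beta> q r s \<and> recurrence_coefficients q r s \<mu> \<and> recurrent_from_3 \<mu> \<longrightarrow>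
      (\<forall>\<epsilon>>0. \<forall>D\<ge>1. \<exists>Q R S :: int. Q > 0 \<and> Gcd {Q, R, S} = 1 \<and>
         \<bar>of_int Q * \<alpha> - of_int R\<bar> \<le> \<epsilon> * of_int Q powr (- 1 / 2) \<and>
         \<bar>of_int Q * \<beta> - of_int S\<bar> \<le> C * of_int Q powr (- 1 / 2) \<and>
         [Q = R] (mod D) \<and> [R = 0] (mod D)) \<and>
      (\<forall>\<epsilon>>0. \<forall>D\<ge>1. \<exists>q' r' s' :: int. q' > 0 \<and>
         of_int q' * \<bar>of_int q' * \<alpha> - of_int r'\<bar> * \<bar>of_int q' * \<beta> - of_int s'\<bar> \<le> \<epsilon> \<and>
         [q' = r'] (mod D) \<and> [r' = 0] (mod D) \<and> Gcd {q', r', s'} = 1)"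
  \<comment> \<open>The conclusion does not mention the sequence, so \<open>C\<close> may be taken from any one sequence.\<close>
proof (cases "\<exists>q r s \<mu>. good_approximation_sequence \<alpha> \<beta> q r s \<and>
    recurrence_coefficients q r s \<mu> \<and> recurrent_from_3 \<mu>")
  case True
  then obtain q r s \<mu> where "good_approximation_sequence \<alpha> \<beta> q r s"
    "recurrence_coefficients q r s \<mu>" "recurrent_from_3 \<mu>" by blast
  from approximation_sequenceI[OF this] obtain c1 c2 K h where
    "approximation_sequence \<alpha> \<beta> q r s \<mu> c1 c2 K h" by blast
  then interpret approximation_sequence \<alpha> \<beta> q r s \<mu> c1 c2 K h .
  obtain C where "C > 0" and C: "\<And>\<epsilon> D. \<epsilon> > 0 \<Longrightarrow> D \<ge> 1 \<Longrightarrow> \<exists>Q R S :: int. Q > 0 \<and>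
     Gcd {Q, R, S} = 1 \<and> D dvd Q \<and> D dvd R \<and>
     sqrt (of_int Q) * \<bar>of_int Q * \<alpha> - of_int R\<bar> \<le> \<epsilon> \<and>
     sqrt (of_int Q) * \<bar>of_int Q * \<beta> - of_int S\<bar> \<le> C"
    using primitive_approximants by blast
  have cong: "[Q = R] (mod D) \<and> [R = 0] (mod D)" if "D dvd Q" "D dvd R" for D Q R :: int
    using that by (simp add: cong_def dvd_eq_mod_eq_0)
  have "\<exists>Q R S :: int. Q > 0 \<and> Gcd {Q, R, S} = 1 \<and>
         \<bar>of_int Q * \<alpha> - of_int R\<bar> \<le> \<epsilon> * of_int Q powr (- 1 / 2) \<and>
         \<bar>of_int Q * \<beta> - of_int S\<bar> \<le> C * of_int Q powr (- 1 / 2) \<and>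
         [Q = R] (mod D) \<and> [R = 0] (mod D)" if "\<epsilon> > 0" "D \<ge> 1" for \<epsilon> D
  proof -
    from C[OF that] obtain Q R S :: int where *: "Q > 0" "Gcd {Q, R, S} = 1" "D dvd Q" "D dvd R"
      "sqrt (of_int Q) * \<bar>of_int Q * \<alpha> - of_int R\<bar> \<le> \<epsilon>"
      "sqrt (of_int Q) * \<bar>of_int Q * \<beta> - of_int S\<bar> \<le> C" by blast
    then have "real_of_int Q > 0" by simp
    with * cong powr_minus_half_bound show ?thesis by blast
  qed
  moreover have "\<exists>q' r' s' :: int. q' > 0 \<and>
         of_int q' * \<bar>of_int q' * \<alpha> - of_int r'\<bar> * \<bar>of_int q' * \<beta> - of_int s'\<bar> \<le> \<epsilon> \<and>
         [q' = r'] (mod D) \<and> [r' = 0] (mod D) \<and> Gcd {q', r', s'} = 1"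
    if "\<epsilon> > 0" "D \<ge> 1" for \<epsilon> D
  proof -
    \<comment> \<open>The product of the two normalised errors is then at most
      \<open>\<epsilon> / C * C\<close>.\<close>
    have "\<epsilon> / C > 0" using that \<open>C > 0\<close> by simp
    from C[OF this that(2)] obtain Q R S :: int where
      *: "Q > 0" "Gcd {Q, R, S} = 1" "D dvd Q" "D dvd R"
      and b: "sqrt (of_int Q) * \<bar>of_int Q * \<alpha> - of_int R\<bar> \<le> \<epsilon> / C"
      "sqrt (of_int Q) * \<bar>of_int Q * \<beta> - of_int S\<bar> \<le> C" by blast
    have "(sqrt (of_int Q) * \<bar>of_int Q * \<alpha> - of_int R\<bar>)
        * (sqrt (of_int Q) * \<bar>of_int Q * \<beta> - of_int S\<bar>) \<le> \<epsilon> / C * C"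
      using b that \<open>C > 0\<close> \<open>Q > 0\<close> by (intro mult_mono) auto
    also have "(sqrt (of_int Q) * \<bar>of_int Q * \<alpha> - of_int R\<bar>)
        * (sqrt (of_int Q) * \<bar>of_int Q * \<beta> - of_int S\<bar>)
      = (sqrt (of_int Q) * sqrt (of_int Q)) * \<bar>of_int Q * \<alpha> - of_int R\<bar> * \<bar>of_int Q * \<beta> - of_int S\<bar>"
      by (simp only: ac_simps)
    finally have "of_int Q * \<bar>of_int Q * \<alpha> - of_int R\<bar> * \<bar>of_int Q * \<beta> - of_int S\<bar> \<le> \<epsilon>"
      using \<open>C > 0\<close> \<open>Q > 0\<close> by simp
    with * cong show ?thesis by blast
  qed
  ultimately show ?thesis using \<open>C > 0\<close> by blast
next
  case False
  \<comment> \<open>Without an admissible sequence the implication is vacuous, and any positive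
    constant serves.\<close>
  then show ?thesis by (intro exI[of _ "1 :: real"]) (simp, blast)
qed

end
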